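(* Let $\mathsf K$ be a double category, and let $f,h\colon a\to b$ be parallel vertical 1-cells of $\mathsf K$ which are left conjoints in conjunctions $f\dashv g$ and $h\dashv k$ in $\mathsf K$ (so that $g,k\colon b\to a$ are horizontal 1-cells, the right conjoints of $f$ and $h$ respectively). Then there is a natural isomorphism $$\mathcal V(\mathsf K)(f,h)\cong\mathcal H(\mathsf K)(k,g),$$ under which isomorphisms $f\cong h$ correspond to isomorphisms $k\cong g$. More generally, for any horizontal 1-cells $i,n$ and vertical 1-cells $j,m$ for which the following boundaries make sense, there is a bijection between squares with top $i$, left side $mh$, right side $fj$, bottom $n$, and squares with top $ik$, left side $m$, right side $j$, bottom $gn$. A pair of squares which correspond under this bijection are called mates.
   Context: A double category $\mathsf K$ has objects; two categories with these objects, whose arrows are called vertical and horizontal 1-cells; and squares (2-cells) with boundary: top horizontal $p\colon w\to x$, left vertical $q\colon w\to y$, right vertical $r\colon x\to z$, bottom horizontal $s\colon y\to z$. Squares compose horizontally, $\alpha\ast_h\beta$ ($\alpha$ on the left, $\beta$ on the right), and vertically, $\beta\ast_v\alpha$ ($\alpha$ on top, $\beta$ below), associatively and unitally and with interchange. The vertical and horizontal identities of an object $a$ are $1_a$ and $1^a$. A vertical $u$ has an identity square $1^u$ (left and right sides $u$, top and bottom identities), and a horizontal $p$ has an identity square $1_p$ (top and bottom $p$, left and right sides identities), with $1^{1_a}=1_{1^a}$, $1^v\ast_v1^u=1^{vu}$, $1_p\ast_h1_q=1_{qp}$. Composites of 1-cells are written in functional order: $mh$ means first $h$, then $m$. $\mathcal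 H(\mathsf K)$ is the 2-category of objects, horizontal 1-cells, and squares with identity left and right sides (a 2-cell from the top to the bottom). $\mathcal V(\mathsf K)$ is the 2-category of objects, vertical 1-cells, and squares with identity top and bottom (a 2-cell from the right side to the left side). $\mathcal V(\mathsf K)(f,h)$ denotes the set of 2-cells $f\to h$ in $\mathcal V(\mathsf K)$, and likewise $\mathcal H(\mathsf K)(k,g)$ the set of 2-cells $k\to g$ in $\mathcal H(\mathsf K)$. A conjunction in $\mathsf K$, here written $f\dashv g$, consists of a vertical 1-cell $f\colon a\to b$ (the left conjoint), a horizontal 1-cell $g\colon b\to a$ (the right conjoint), and squares $\eta$ (top $1^a$, left $f$, right $1_a$, bottom $g$) and $\varepsilon$ (top $g$, left $1_b$, right $f$, bottom $1^b$) with $\varepsilon\ast_h\eta=1_g$ and $\varepsilon\ast_v\eta=1^f$. *)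

theory Defs imports Main begin

text \<open>Composition is written in functional order: \<open>cmp g f\<close> means first \<open>f\<close>, then \<open>g\<close>, and is
  constrained only on composable pairs.\<close>

locale carrier_category =
  fixes Ob :: "'a set" and Ar :: "'b set"
    and src tgt :: "'b \<Rightarrow> 'a" and ident :: "'a \<Rightarrow> 'b" and cmp :: "'b \<Rightarrow> 'b \<Rightarrow> 'b"
  assumes src_in: "f \<in> Ar \<Longrightarrow> src f \<in> Ob"
    and tgt_in: "f \<in> Ar \<Longrightarrow> tgt f \<in> Ob"
    and ident_in: "x \<in> Ob \<Longrightarrow> ident x \<in> Ar"
    and src_ident: "x \<in> Ob \<Longrightarrow> src (ident x) = x"
    and tgt_ident: "x \<in> Ob \<Longrightarrow> tgt (ident x) = x"
    and cmp_in: "\<lbrakk>f \<in> Ar; g \<in> Ar; tgt f = src g\<rbrakk> \<Longrightarrow> cmp g f \<in> Ar"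
    and src_cmp: "\<lbrakk>f \<in> Ar; g \<in> Ar; tgt f = src g\<rbrakk> \<Longrightarrow> src (cmp g f) = src f"
    and tgt_cmp: "\<lbrakk>f \<in> Ar; g \<in> Ar; tgt f = src g\<rbrakk> \<Longrightarrow> tgt (cmp g f) = tgt g"
    and cmp_ident_right: "f \<in> Ar \<Longrightarrow> cmp f (ident (src f)) = f"
    and cmp_ident_left: "f \<in> Ar \<Longrightarrow> cmp (ident (tgt f)) f = f"
    and cmp_assoc: "\<lbrakk>f \<in> Ar; g \<in> Ar; h \<in> Ar; tgt f = src g; tgt g = src h\<rbrakk>
      \<Longrightarrow> cmp h (cmp g f) = cmp (cmp h g) f"

text \<open>\<open>vid\<close>, \<open>hid\<close> are the identities $1_a$, $1^a$ of an object; \<open>vsqid u\<close> is the square $1^u$ and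
  \<open>hsqid p\<close> the square $1_p$.  In \<open>\<alpha> \<ast>\<^sub>h \<beta>\<close> the square \<open>\<alpha>\<close> is on the left; in \<open>\<beta> \<ast>\<^sub>v \<alpha>\<close> the square
  \<open>\<alpha>\<close> is on top.\<close>

record ('o, 'v, 'h, 's) double_cat =
  Obj :: "'o set"
  Ver :: "'v set"
  Hor :: "'h set"
  Sq :: "'s set"
  vdom :: "'v \<Rightarrow> 'o"
  vcod :: "'v \<Rightarrow> 'o"
  vid :: "'o \<Rightarrow> 'v"
  vcomp :: "'v \<Rightarrow> 'v \<Rightarrow> 'v"  (infixr "\<cdot>\<^sub>v\<index>" 75)
  hdom :: "'h \<Rightarrow> 'o"
  hcod :: "'h \<Rightarrow> 'o"
  hid :: "'o \<Rightarrow> 'h"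
  hcomp :: "'h \<Rightarrow> 'h \<Rightarrow> 'h"  (infixr "\<cdot>\<^sub>h\<index>" 75)
  sqtop :: "'s \<Rightarrow> 'h"
  sqleft :: "'s \<Rightarrow> 'v"
  sqright :: "'s \<Rightarrow> 'v"
  sqbot :: "'s \<Rightarrow> 'h"
  vsqid :: "'v \<Rightarrow> 's"
  hsqid :: "'h \<Rightarrow> 's"
  hsqcomp :: "'s \<Rightarrow> 's \<Rightarrow> 's"  (infixr "\<ast>\<^sub>h\<index>" 70)
  vsqcomp :: "'s \<Rightarrow> 's \<Rightarrow> 's"  (infixr "\<ast>\<^sub>v\<index>" 70)

text \<open>Squares form a category in two ways: from left side to right side under \<open>\<ast>\<^sub>h\<close>, with vertical
  1-cells as objects, and from top to bottom under \<open>\<ast>\<^sub>v\<close>, with horizontal 1-cells as objects.\<close>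

locale double_category =
  fixes K :: "('o, 'v, 'h, 's) double_cat" (structure)
  assumes ver_category: "carrier_category (Obj K) (Ver K) (vdom K) (vcod K) (vid K) (vcomp K)"
    and hor_category: "carrier_category (Obj K) (Hor K) (hdom K) (hcod K) (hid K) (hcomp K)"
    and hsq_category: "carrier_category (Ver K) (Sq K) (sqleft K) (sqright K) (vsqid K)
      (\<lambda>\<beta> \<alpha>. \<alpha> \<ast>\<^sub>h \<beta>)"
    and vsq_category: "carrier_category (Hor K) (Sq K) (sqtop K) (sqbot K) (hsqid K)
      (\<lambda>\<beta> \<alpha>. \<beta> \<ast>\<^sub>v \<alpha>)"
    and corner_top_left: "\<alpha> \<in> Sq K \<Longrightarrow> hdom K (sqtop K \<alpha>) = vdom K (sqleft K \<alpha>)"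
    and corner_top_right: "\<alpha> \<in> Sq K \<Longrightarrow> hcod K (sqtop K \<alpha>) = vdom K (sqright K \<alpha>)"
    and corner_bot_left: "\<alpha> \<in> Sq K \<Longrightarrow> hdom K (sqbot K \<alpha>) = vcod K (sqleft K \<alpha>)"
    and corner_bot_right: "\<alpha> \<in> Sq K \<Longrightarrow> hcod K (sqbot K \<alpha>) = vcod K (sqright K \<alpha>)"
    and top_hsqcomp: "\<lbrakk>\<alpha> \<in> Sq K; \<beta> \<in> Sq K; sqright K \<alpha> = sqleft K \<beta>\<rbrakk>
      \<Longrightarrow> sqtop K (\<alpha> \<ast>\<^sub>h \<beta>) = sqtop K \<beta> \<cdot>\<^sub>h sqtop K \<alpha>"
    and bot_hsqcomp: "\<lbrakk>\<alpha> \<in> Sq K; \<beta> \<in> Sq K; sqright K \<alpha> = sqleft K \<beta>\<rbrakk>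
      \<Longrightarrow> sqbot K (\<alpha> \<ast>\<^sub>h \<beta>) = sqbot K \<beta> \<cdot>\<^sub>h sqbot K \<alpha>"
    and left_vsqcomp: "\<lbrakk>\<alpha> \<in> Sq K; \<beta> \<in> Sq K; sqbot K \<alpha> = sqtop K \<beta>\<rbrakk>
      \<Longrightarrow> sqleft K (\<beta> \<ast>\<^sub>v \<alpha>) = sqleft K \<beta> \<cdot>\<^sub>v sqleft K \<alpha>"
    and right_vsqcomp: "\<lbrakk>\<alpha> \<in> Sq K; \<beta> \<in> Sq K; sqbot K \<alpha> = sqtop K \<beta>\<rbrakk>
      \<Longrightarrow> sqright K (\<beta> \<ast>\<^sub>v \<alpha>) = sqright K \<beta> \<cdot>\<^sub>v sqright K \<alpha>"
    and top_vsqid: "u \<in> Ver K \<Longrightarrow> sqtop K (vsqid K u) = hid K (vdom K u)"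
    and bot_vsqid: "u \<in> Ver K \<Longrightarrow> sqbot K (vsqid K u) = hid K (vcod K u)"
    and left_hsqid: "p \<in> Hor K \<Longrightarrow> sqleft K (hsqid K p) = vid K (hdom K p)"
    and right_hsqid: "p \<in> Hor K \<Longrightarrow> sqright K (hsqid K p) = vid K (hcod K p)"
    and vsqid_vid: "a \<in> Obj K \<Longrightarrow> vsqid K (vid K a) = hsqid K (hid K a)"
    and vsqid_vcomp: "\<lbrakk>u \<in> Ver K; v \<in> Ver K; vcod K u = vdom K v\<rbrakk>
      \<Longrightarrow> vsqid K v \<ast>\<^sub>v vsqid K u = vsqid K (v \<cdot>\<^sub>v u)"
    and hsqid_hcomp: "\<lbrakk>p \<in> Hor K; q \<in> Hor K; hcod K p = hdom K q\<rbrakk>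
      \<Longrightarrow> hsqid K p \<ast>\<^sub>h hsqid K q = hsqid K (q \<cdot>\<^sub>h p)"
    and interchange: "\<lbrakk>\<alpha> \<in> Sq K; \<beta> \<in> Sq K; \<gamma> \<in> Sq K; \<delta> \<in> Sq K;
        sqright K \<alpha> = sqleft K \<beta>; sqright K \<gamma> = sqleft K \<delta>;
        sqbot K \<alpha> = sqtop K \<gamma>; sqbot K \<beta> = sqtop K \<delta>\<rbrakk>
      \<Longrightarrow> (\<gamma> \<ast>\<^sub>h \<delta>) \<ast>\<^sub>v (\<alpha> \<ast>\<^sub>h \<beta>) = (\<gamma> \<ast>\<^sub>v \<alpha>) \<ast>\<^sub>h (\<delta> \<ast>\<^sub>v \<beta>)"

definition vhom :: "('o, 'v, 'h, 's) double_cat \<Rightarrow> 'o \<Rightarrow> 'o \<Rightarrow> 'v set" where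
  "vhom K a b = {u \<in> Ver K. vdom K u = a \<and> vcod K u = b}"

definition hhom :: "('o, 'v, 'h, 's) double_cat \<Rightarrow> 'o \<Rightarrow> 'o \<Rightarrow> 'h set" where
  "hhom K a b = {p \<in> Hor K. hdom K p = a \<and> hcod K p = b}"

text \<open>Arguments in the order top, left, right, bottom.\<close>

definition squares :: "('o, 'v, 'h, 's) double_cat \<Rightarrow> 'h \<Rightarrow> 'v \<Rightarrow> 'v \<Rightarrow> 'h \<Rightarrow> 's set" where
  "squares K p q r s =
    {\<alpha> \<in> Sq K. sqtop K \<alpha> = p \<and> sqleft K \<alpha> = q \<and> sqright K \<alpha> = r \<and> sqbot K \<alpha> = s}"

text \<open>2-cells \<open>u \<rightarrow> v\<close> of $\mathcal V(\mathsf K)$ go from the right side to the left side, so that the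
  composite of \<open>\<phi> : u \<rightarrow> v\<close> and \<open>\<psi> : v \<rightarrow> w\<close> is \<open>\<psi> \<ast>\<^sub>h \<phi>\<close>; 2-cells of $\mathcal H(\mathsf K)$ go from
  top to bottom.\<close>

definition V2cells :: "('o, 'v, 'h, 's) double_cat \<Rightarrow> 'v \<Rightarrow> 'v \<Rightarrow> 's set" where
  "V2cells K u v = squares K (hid K (vdom K u)) v u (hid K (vcod K u))"

definition H2cells :: "('o, 'v, 'h, 's) double_cat \<Rightarrow> 'h \<Rightarrow> 'h \<Rightarrow> 's set" where
  "H2cells K p q = squares K p (vid K (hdom K p)) (vid K (hcod K p)) q"

definition V2comp :: "('o, 'v, 'h, 's) double_cat \<Rightarrow> 's \<Rightarrow> 's \<Rightarrow> 's" where
  "V2comp K \<psi> \<phi> = hsqcomp K \<psi> \<phi>"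

definition H2comp :: "('o, 'v, 'h, 's) double_cat \<Rightarrow> 's \<Rightarrow> 's \<Rightarrow> 's" where
  "H2comp K \<psi> \<phi> = vsqcomp K \<psi> \<phi>"

definition V2iso :: "('o, 'v, 'h, 's) double_cat \<Rightarrow> 'v \<Rightarrow> 'v \<Rightarrow> 's \<Rightarrow> bool" where
  "V2iso K u v \<phi> \<longleftrightarrow> \<phi> \<in> V2cells K u v \<and>
    (\<exists>\<psi> \<in> V2cells K v u. V2comp K \<psi> \<phi> = vsqid K u \<and> V2comp K \<phi> \<psi> = vsqid K v)"

definition H2iso :: "('o, 'v, 'h, 's) double_cat \<Rightarrow> 'h \<Rightarrow> 'h \<Rightarrow> 's \<Rightarrow> bool" where
  "H2iso K p q \<phi> \<longleftrightarrow> \<phi> \<in> H2cells K p q \<and>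
    (\<exists>\<psi> \<in> H2cells K q p. H2comp K \<psi> \<phi> = hsqid K p \<and> H2comp K \<phi> \<psi> = hsqid K q)"

definition conjunction ::
  "('o, 'v, 'h, 's) double_cat \<Rightarrow> 'o \<Rightarrow> 'o \<Rightarrow> 'v \<Rightarrow> 'h \<Rightarrow> 's \<Rightarrow> 's \<Rightarrow> bool" where
  "conjunction K a b f g \<eta> \<epsilon> \<longleftrightarrow>
    a \<in> Obj K \<and> b \<in> Obj K \<and> f \<in> vhom K a b \<and> g \<in> hhom K b a \<and>
    \<eta> \<in> squares K (hid K a) f (vid K a) g \<and>
    \<epsilon> \<in> squares K g (vid K b) f (hid K b) \<and>
    hsqcomp K \<epsilon> \<eta> = hsqid K g \<and> vsqcomp K \<epsilon> \<eta> = vsqid K f"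

text \<open>The mate of a square \<open>\<alpha>\<close> with left side $mh$ and right side $fj$ is obtained by pasting the
  counit \<open>\<epsilon>\<close> of the conjunction of $h$, extended below by $1^m$, to its left, and the unit \<open>\<eta>\<close> of the
  conjunction of $f$, extended above by $1^j$, to its right.  (The 1-cells \<open>m\<close> and \<open>j\<close> are arguments
  because they are not determined by the boundary of \<open>\<alpha>\<close>.)\<close>

definition mate :: "('o, 'v, 'h, 's) double_cat \<Rightarrow> 's \<Rightarrow> 's \<Rightarrow> 'v \<Rightarrow> 'v \<Rightarrow> 's \<Rightarrow> 's" where
  "mate K \<epsilon> \<eta> m j \<alpha> =
    hsqcomp K (vsqcomp K (vsqid K m) \<epsilon>) (hsqcomp K \<alpha> (vsqcomp K \<eta> (vsqid K j)))"

definition mate2 :: "('o, 'v, 'h, 's) double_cat \<Rightarrow> 'o \<Rightarrow> 'o \<Rightarrow> 's \<Rightarrow> 's \<Rightarrow> 's \<Rightarrow> 's" where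
  "mate2 K a b \<epsilon> \<eta> = mate K \<epsilon> \<eta> (vid K b) (vid K a)"

end

theory Submission imports Defs begin

text \<open>The mate of a square is formed with \<open>\<epsilon>\<close> of \<open>h \<stileturn> k\<close> and \<open>\<eta>\<close> of \<open>f \<stileturn> g\<close>; pasting dually
  with \<open>\<eta>\<close> of \<open>h \<stileturn> k\<close> and \<open>\<epsilon>\<close> of \<open>f \<stileturn> g\<close> is inverse to it.  Either composite is a three-by-three
  grid.  In one order interchange turns the rows into columns, which collapse by the conjunction
  laws \<open>\<epsilon> \<ast>\<^sub>v \<eta> = 1\<^sup>f\<close>; in the other order it turns the columns into rows, which collapse by
  \<open>\<epsilon> \<ast>\<^sub>h \<eta> = 1\<^sub>g\<close>.  Functoriality of mates is one further collapse of the same kind, and it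
  gives the correspondence of isomorphisms.\<close>

context double_category
begin

lemma squaresI:
  "\<lbrakk>\<alpha> \<in> Sq K; sqtop K \<alpha> = p; sqleft K \<alpha> = q; sqright K \<alpha> = r; sqbot K \<alpha> = s\<rbrakk>
    \<Longrightarrow> \<alpha> \<in> squares K p q r s"
  by (simp add: squares_def)

lemma squaresD:
  assumes "\<alpha> \<in> squares K p q r s"
  shows "\<alpha> \<in> Sq K" "sqtop K \<alpha> = p" "sqleft K \<alpha> = q" "sqright K \<alpha> = r" "sqbot K \<alpha> = s"
  using assms by (simp_all add: squares_def)

lemma vhomD:
  assumes "u \<in> vhom K a b"
  shows "u \<in> Ver K" "vdom K u = a" "vcod K u = b"
  using assms by (simp_all add: vhom_def)

lemma hhomD:
  assumes "p \<in> hhom K a b"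
  shows "p \<in> Hor K" "hdom K p = a" "hcod K p = b"
  using assms by (simp_all add: hhom_def)

lemma conjunctionD:
  assumes "conjunction K a b f g \<eta> \<epsilon>"
  shows "a \<in> Obj K" "b \<in> Obj K" "f \<in> vhom K a b" "g \<in> hhom K b a"
    "\<eta> \<in> squares K (hid K a) f (vid K a) g" "\<epsilon> \<in> squares K g (vid K b) f (hid K b)"
    "\<epsilon> \<ast>\<^sub>h \<eta> = hsqid K g" "\<epsilon> \<ast>\<^sub>v \<eta> = vsqid K f"
  using assms by (simp_all add: conjunction_def)

text \<open>As conditional rewrite rules these compute all four sides of any pasting. Added to the
  simpset inside a proof, they let \<open>simp_all\<close> discharge the matching conditions of
  \<open>interchange\<close>.\<close>

lemmas bdry_simps =
  carrier_category.src_in[OF ver_category] carrier_category.tgt_in[OF ver_category]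
  carrier_category.src_in[OF hor_category] carrier_category.tgt_in[OF hor_category]
  carrier_category.src_in[OF hsq_category] carrier_category.tgt_in[OF hsq_category]
  carrier_category.src_in[OF vsq_category] carrier_category.tgt_in[OF vsq_category]
  carrier_category.ident_in[OF ver_category] carrier_category.ident_in[OF hor_category]
  carrier_category.ident_in[OF hsq_category] carrier_category.ident_in[OF vsq_category]
  carrier_category.src_ident[OF ver_category] carrier_category.tgt_ident[OF ver_category]
  carrier_category.src_ident[OF hor_category] carrier_category.tgt_ident[OF hor_category]
  carrier_category.src_ident[OF hsq_category] carrier_category.tgt_ident[OF hsq_category]
  carrier_category.src_ident[OF vsq_category] carrier_category.tgt_ident[OF vsq_category]
  carrier_category.cmp_in[OF ver_category] carrier_category.cmp_in[OF hor_category]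
  carrier_category.cmp_in[OF hsq_category] carrier_category.cmp_in[OF vsq_category]
  carrier_category.src_cmp[OF ver_category] carrier_category.tgt_cmp[OF ver_category]
  carrier_category.src_cmp[OF hor_category] carrier_category.tgt_cmp[OF hor_category]
  carrier_category.src_cmp[OF hsq_category] carrier_category.tgt_cmp[OF hsq_category]
  carrier_category.src_cmp[OF vsq_category] carrier_category.tgt_cmp[OF vsq_category]
  corner_top_left corner_top_right corner_bot_left corner_bot_right
  top_hsqcomp bot_hsqcomp left_vsqcomp right_vsqcomp
  top_vsqid bot_vsqid left_hsqid right_hsqid

text \<open>The unit laws take the identity 1-cell through an equation, so that they apply whatever form
  the boundary has.\<close>

lemma vcomp_vid [simp]:
  "u \<in> Ver K \<Longrightarrow> vdom K u = x \<Longrightarrow> u \<cdot>\<^sub>v vid K x = u"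
  "u \<in> Ver K \<Longrightarrow> vcod K u = x \<Longrightarrow> vid K x \<cdot>\<^sub>v u = u"
  using carrier_category.cmp_ident_right[OF ver_category]
    carrier_category.cmp_ident_left[OF ver_category] by auto

lemma hcomp_hid [simp]:
  "p \<in> Hor K \<Longrightarrow> hdom K p = x \<Longrightarrow> p \<cdot>\<^sub>h hid K x = p"
  "p \<in> Hor K \<Longrightarrow> hcod K p = x \<Longrightarrow> hid K x \<cdot>\<^sub>h p = p"
  using carrier_category.cmp_ident_right[OF hor_category]
    carrier_category.cmp_ident_left[OF hor_category] by auto

lemma hsqcomp_vsqid [simp]:
  "\<alpha> \<in> Sq K \<Longrightarrow> sqleft K \<alpha> = u \<Longrightarrow> vsqid K u \<ast>\<^sub>h \<alpha> = \<alpha>"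
  "\<alpha> \<in> Sq K \<Longrightarrow> sqright K \<alpha> = u \<Longrightarrow> \<alpha> \<ast>\<^sub>h vsqid K u = \<alpha>"
  using carrier_category.cmp_ident_right[OF hsq_category]
    carrier_category.cmp_ident_left[OF hsq_category] by auto

lemma vsqcomp_hsqid [simp]:
  "\<alpha> \<in> Sq K \<Longrightarrow> sqtop K \<alpha> = p \<Longrightarrow> \<alpha> \<ast>\<^sub>v hsqid K p = \<alpha>"
  "\<alpha> \<in> Sq K \<Longrightarrow> sqbot K \<alpha> = p \<Longrightarrow> hsqid K p \<ast>\<^sub>v \<alpha> = \<alpha>"
  using carrier_category.cmp_ident_right[OF vsq_category]
    carrier_category.cmp_ident_left[OF vsq_category] by auto

text \<open>By \<open>vsqid_vid\<close> this square is also the horizontal unit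
  \<open>vsqid K (vid K x)\<close>. It can therefore pad a row of a grid without changing its
  value.\<close>

lemma hsqcomp_hsqid_hid [simp]:
  "\<alpha> \<in> Sq K \<Longrightarrow> sqleft K \<alpha> = vid K x \<Longrightarrow> x \<in> Obj K \<Longrightarrow> hsqid K (hid K x) \<ast>\<^sub>h \<alpha> = \<alpha>"
  "\<alpha> \<in> Sq K \<Longrightarrow> sqright K \<alpha> = vid K x \<Longrightarrow> x \<in> Obj K \<Longrightarrow> \<alpha> \<ast>\<^sub>h hsqid K (hid K x) = \<alpha>"
  by (metis vsqid_vid hsqcomp_vsqid(1)) (metis vsqid_vid hsqcomp_vsqid(2))

lemma vcomp_assoc:
  "\<lbrakk>u \<in> Ver K; v \<in> Ver K; w \<in> Ver K; vcod K u = vdom K v; vcod K v = vdom K w\<rbrakk>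
    \<Longrightarrow> (w \<cdot>\<^sub>v v) \<cdot>\<^sub>v u = w \<cdot>\<^sub>v (v \<cdot>\<^sub>v u)"
  using carrier_category.cmp_assoc[OF ver_category] by simp

lemma hsqcomp_assoc:
  "\<lbrakk>\<alpha> \<in> Sq K; \<beta> \<in> Sq K; \<gamma> \<in> Sq K; sqright K \<alpha> = sqleft K \<beta>; sqright K \<beta> = sqleft K \<gamma>\<rbrakk>
    \<Longrightarrow> (\<alpha> \<ast>\<^sub>h \<beta>) \<ast>\<^sub>h \<gamma> = \<alpha> \<ast>\<^sub>h (\<beta> \<ast>\<^sub>h \<gamma>)"
  using carrier_category.cmp_assoc[OF hsq_category, of \<alpha> \<beta> \<gamma>] by simp

lemma vsqcomp_assoc:
  "\<lbrakk>\<alpha> \<in> Sq K; \<beta> \<in> Sq K; \<gamma> \<in> Sq K; sqbot K \<alpha> = sqtop K \<beta>; sqbot K \<beta> = sqtop K \<gamma>\<rbrakk>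
    \<Longrightarrow> (\<gamma> \<ast>\<^sub>v \<beta>) \<ast>\<^sub>v \<alpha> = \<gamma> \<ast>\<^sub>v (\<beta> \<ast>\<^sub>v \<alpha>)"
  using carrier_category.cmp_assoc[OF vsq_category, of \<alpha> \<beta> \<gamma>] by simp

text \<open>The middle column of the two-by-three grid is \<open>\<epsilon> \<ast>\<^sub>v \<eta>\<close>.\<close>

lemma conjunction_cancel:
  assumes c: "conjunction K a b f g \<eta> \<epsilon>"
    and X: "\<xi> \<in> squares K p q f (hid K b)"
    and Y: "\<zeta> \<in> squares K (hid K a) f r s"
  shows "(\<epsilon> \<ast>\<^sub>h \<zeta>) \<ast>\<^sub>v (\<xi> \<ast>\<^sub>h \<eta>) = \<xi> \<ast>\<^sub>h \<zeta>"
proof -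
  note [simp] = bdry_simps conjunctionD[OF c] squaresD[OF X] squaresD[OF Y]
    vhomD[OF conjunctionD(3)[OF c]] hhomD[OF conjunctionD(4)[OF c]]
    squaresD[OF conjunctionD(5)[OF c]] squaresD[OF conjunctionD(6)[OF c]]
  \<comment> \<open>Padding aligns the two rows: \<xi>, \<eta>, identity on top and identity,
    \<epsilon>, \<zeta> below. Interchange then splits off the last column, and a second use
    separates the first two.\<close>
  have "(\<epsilon> \<ast>\<^sub>h \<zeta>) \<ast>\<^sub>v (\<xi> \<ast>\<^sub>h \<eta>)
      = ((hsqid K (hid K b) \<ast>\<^sub>h \<epsilon>) \<ast>\<^sub>h \<zeta>) \<ast>\<^sub>v ((\<xi> \<ast>\<^sub>h \<eta>) \<ast>\<^sub>h hsqid K (hid K a))"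
    by simp
  also have "\<dots> = ((hsqid K (hid K b) \<ast>\<^sub>h \<epsilon>) \<ast>\<^sub>v (\<xi> \<ast>\<^sub>h \<eta>)) \<ast>\<^sub>h (\<zeta> \<ast>\<^sub>v hsqid K (hid K a))"
    by (rule interchange) simp_all
  also have "(hsqid K (hid K b) \<ast>\<^sub>h \<epsilon>) \<ast>\<^sub>v (\<xi> \<ast>\<^sub>h \<eta>)
      = (hsqid K (hid K b) \<ast>\<^sub>v \<xi>) \<ast>\<^sub>h (\<epsilon> \<ast>\<^sub>v \<eta>)"
    by (rule interchange) simp_all
  finally show ?thesis by simp
qed

text \<open>The transpose of \<open>mate\<close>: \<eta> goes on top, extended to the right by
  \<open>hsqid K i\<close>, and \<epsilon> below, extended to the left by \<open>hsqid K n\<close>.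
  The 1-cells \<open>i\<close> and \<open>n\<close> are arguments because the boundary of \<beta>
  shows only composites containing them.\<close>

definition unmate :: "'s \<Rightarrow> 's \<Rightarrow> 'h \<Rightarrow> 'h \<Rightarrow> 's \<Rightarrow> 's" where
  "unmate \<epsilon> \<eta> i n \<beta> = (hsqid K n \<ast>\<^sub>h \<epsilon>) \<ast>\<^sub>v \<beta> \<ast>\<^sub>v (\<eta> \<ast>\<^sub>h hsqid K i)"

lemma bij_betw_mate:
  assumes f: "conjunction K a b f g \<eta>\<^sub>f \<epsilon>\<^sub>f" and h: "conjunction K a b h k \<eta>\<^sub>h \<epsilon>\<^sub>h"
    and i: "i \<in> hhom K a x" and n: "n \<in> hhom K y b"
    and j: "j \<in> vhom K x a" and m: "m \<in> vhom K b y"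
  shows "bij_betw (mate K \<epsilon>\<^sub>h \<eta>\<^sub>f m j)
    (squares K i (m \<cdot>\<^sub>v h) (f \<cdot>\<^sub>v j) n) (squares K (i \<cdot>\<^sub>h k) m j (g \<cdot>\<^sub>h n))"
proof -
  have [simp]: "x \<in> Obj K" "y \<in> Obj K"
    using hhomD[OF i] hhomD[OF n] bdry_simps by blast+
  note [simp] = bdry_simps vcomp_assoc
    conjunctionD[OF f] vhomD[OF conjunctionD(3)[OF f]] hhomD[OF conjunctionD(4)[OF f]]
    squaresD[OF conjunctionD(5)[OF f]] squaresD[OF conjunctionD(6)[OF f]]
    conjunctionD[OF h] vhomD[OF conjunctionD(3)[OF h]] hhomD[OF conjunctionD(4)[OF h]]
    squaresD[OF conjunctionD(5)[OF h]] squaresD[OF conjunctionD(6)[OF h]]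
    hhomD[OF i] hhomD[OF n] vhomD[OF j] vhomD[OF m]
  \<comment> \<open>The extended counit and unit that \<open>mate\<close> pastes on. The next four
    facts collapse the outer strips of the grids: left and right column for \<open>unmate\<close>
    after \<open>mate\<close>, top and bottom row for the other order.\<close>
  let ?E = "vsqid K m \<ast>\<^sub>v \<epsilon>\<^sub>h" and ?N = "\<eta>\<^sub>f \<ast>\<^sub>v vsqid K j"
  have E\<eta>: "?E \<ast>\<^sub>v \<eta>\<^sub>h = vsqid K (m \<cdot>\<^sub>v h)"
    by (simp add: vsqcomp_assoc vsqid_vcomp)
  have \<epsilon>N: "\<epsilon>\<^sub>f \<ast>\<^sub>v ?N = vsqid K (f \<cdot>\<^sub>v j)"
    by (simp add: vsqcomp_assoc[symmetric] vsqid_vcomp)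
  have \<epsilon>\<eta>i: "\<epsilon>\<^sub>h \<ast>\<^sub>h \<eta>\<^sub>h \<ast>\<^sub>h hsqid K i = hsqid K (i \<cdot>\<^sub>h k)"
    by (simp add: hsqcomp_assoc[symmetric] hsqid_hcomp)
  have n\<epsilon>\<eta>: "(hsqid K n \<ast>\<^sub>h \<epsilon>\<^sub>f) \<ast>\<^sub>h \<eta>\<^sub>f = hsqid K (g \<cdot>\<^sub>h n)"
    by (simp add: hsqcomp_assoc hsqid_hcomp)
  show ?thesis
  proof (rule bij_betw_byWitness[where f' = "unmate \<epsilon>\<^sub>f \<eta>\<^sub>h i n"])
    show "\<forall>\<alpha>\<in>squares K i (m \<cdot>\<^sub>v h) (f \<cdot>\<^sub>v j) n. unmate \<epsilon>\<^sub>f \<eta>\<^sub>h i n (mate K \<epsilon>\<^sub>h \<eta>\<^sub>f m j \<alpha>) = \<alpha>"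
    proof
      fix \<alpha> assume "\<alpha> \<in> squares K i (m \<cdot>\<^sub>v h) (f \<cdot>\<^sub>v j) n"
      note [simp] = squaresD[OF this]
      \<comment> \<open>The top of \<open>?N\<close> is an identity, so \<open>hsqid K i\<close>
        alone covers \<open>\<alpha> \<ast>\<^sub>h ?N\<close> and one two-by-two interchange
        isolates the left column.\<close>
      have "(?E \<ast>\<^sub>h \<alpha> \<ast>\<^sub>h ?N) \<ast>\<^sub>v (\<eta>\<^sub>h \<ast>\<^sub>h hsqid K i) = (?E \<ast>\<^sub>v \<eta>\<^sub>h) \<ast>\<^sub>h ((\<alpha> \<ast>\<^sub>h ?N) \<ast>\<^sub>v hsqid K i)"
        by (rule interchange) simp_all
      also have "\<dots> = \<alpha> \<ast>\<^sub>h ?N"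
        by (simp add: E\<eta>)
      finally have "unmate \<epsilon>\<^sub>f \<eta>\<^sub>h i n (mate K \<epsilon>\<^sub>h \<eta>\<^sub>f m j \<alpha>) = (hsqid K n \<ast>\<^sub>h \<epsilon>\<^sub>f) \<ast>\<^sub>v (\<alpha> \<ast>\<^sub>h ?N)"
        by (simp add: unmate_def mate_def)
      also have "\<dots> = (hsqid K n \<ast>\<^sub>v \<alpha>) \<ast>\<^sub>h (\<epsilon>\<^sub>f \<ast>\<^sub>v ?N)"
        by (rule interchange) simp_all
      finally show "unmate \<epsilon>\<^sub>f \<eta>\<^sub>h i n (mate K \<epsilon>\<^sub>h \<eta>\<^sub>f m j \<alpha>) = \<alpha>"
        by (simp add: \<epsilon>N)
    qed
    show "\<forall>\<beta>\<in>squares K (i \<cdot>\<^sub>h k) m j (g \<cdot>\<^sub>h n). mate K \<epsilon>\<^sub>h \<eta>\<^sub>f m j (unmate \<epsilon>\<^sub>f \<eta>\<^sub>h i n \<beta>) = \<beta>"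
    proof
      fix \<beta> assume "\<beta> \<in> squares K (i \<cdot>\<^sub>h k) m j (g \<cdot>\<^sub>h n)"
      note [simp] = squaresD[OF this]
      let ?B = "\<beta> \<ast>\<^sub>v (\<eta>\<^sub>h \<ast>\<^sub>h hsqid K i)"
      \<comment> \<open>Here the cut is horizontal: the right side of \<open>?B\<close> is just
        \<open>j\<close>, so \<open>vsqid K j\<close> stands beside all of \<open>?B\<close> and the
        bottom row separates.\<close>
      have "unmate \<epsilon>\<^sub>f \<eta>\<^sub>h i n \<beta> \<ast>\<^sub>h ?N = ((hsqid K n \<ast>\<^sub>h \<epsilon>\<^sub>f) \<ast>\<^sub>h \<eta>\<^sub>f) \<ast>\<^sub>v (?B \<ast>\<^sub>h vsqid K j)"
        unfolding unmate_def by (rule interchange[symmetric]) simp_all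
      also have "\<dots> = ?B"
        by (subst n\<epsilon>\<eta>) simp
      finally have "mate K \<epsilon>\<^sub>h \<eta>\<^sub>f m j (unmate \<epsilon>\<^sub>f \<eta>\<^sub>h i n \<beta>) = ?E \<ast>\<^sub>h ?B"
        by (simp add: mate_def)
      also have "\<dots> = (vsqid K m \<ast>\<^sub>h \<beta>) \<ast>\<^sub>v (\<epsilon>\<^sub>h \<ast>\<^sub>h \<eta>\<^sub>h \<ast>\<^sub>h hsqid K i)"
        by (rule interchange[symmetric]) simp_all
      also have "\<dots> = \<beta>"
        by (subst \<epsilon>\<eta>i) simp
      finally show "mate K \<epsilon>\<^sub>h \<eta>\<^sub>f m j (unmate \<epsilon>\<^sub>f \<eta>\<^sub>h i n \<beta>) = \<beta>" .
    qed
    show "mate K \<epsilon>\<^sub>h \<eta>\<^sub>f m j ` squares K i (m \<cdot>\<^sub>v h) (f \<cdot>\<^sub>v j) n \<subseteq> squares K (i \<cdot>\<^sub>h k) m j (g \<cdot>\<^sub>h n)"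
      by (auto simp: mate_def squares_def)
    show "unmate \<epsilon>\<^sub>f \<eta>\<^sub>h i n ` squares K (i \<cdot>\<^sub>h k) m j (g \<cdot>\<^sub>h n) \<subseteq> squares K i (m \<cdot>\<^sub>v h) (f \<cdot>\<^sub>v j) n"
    proof (rule image_subsetI)
      fix \<beta> assume "\<beta> \<in> squares K (i \<cdot>\<^sub>h k) m j (g \<cdot>\<^sub>h n)"
      note [simp] = squaresD[OF this]
      show "unmate \<epsilon>\<^sub>f \<eta>\<^sub>h i n \<beta> \<in> squares K i (m \<cdot>\<^sub>v h) (f \<cdot>\<^sub>v j) n"
        unfolding unmate_def by (rule squaresI) simp_all
    qed
  qed
qed

lemma V2cells_eq:
  "conjunction K a b f g \<eta> \<epsilon> \<Longrightarrow> V2cells K f h = squares K (hid K a) h f (hid K b)"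
  by (auto simp: V2cells_def dest: conjunctionD vhomD)

lemma H2cells_eq:
  "conjunction K a b f g \<eta> \<epsilon> \<Longrightarrow> H2cells K g q = squares K g (vid K b) (vid K a) q"
  by (auto simp: H2cells_def dest: conjunctionD hhomD)

text \<open>For identity \<open>m\<close> and \<open>j\<close> the extending squares are vertical
  units by \<open>vsqid_vid\<close>, which leaves a plain horizontal pasting.\<close>

lemma mate2_eq:
  assumes f: "conjunction K a b f g \<eta>\<^sub>f \<epsilon>\<^sub>f" and h: "conjunction K a b h k \<eta>\<^sub>h \<epsilon>\<^sub>h"
  shows "mate2 K a b \<epsilon>\<^sub>h \<eta>\<^sub>f \<alpha> = \<epsilon>\<^sub>h \<ast>\<^sub>h \<alpha> \<ast>\<^sub>h \<eta>\<^sub>f"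
  by (simp add: mate2_def mate_def vsqid_vid conjunctionD[OF f]
      squaresD[OF conjunctionD(5)[OF f]] squaresD[OF conjunctionD(6)[OF h]])

text \<open>The general bijection with all four of \<open>i\<close>, \<open>n\<close>,
  \<open>j\<close>, \<open>m\<close> identities; the unit laws simplify both boundaries.\<close>

lemma bij_betw_mate2:
  assumes f: "conjunction K a b f g \<eta>\<^sub>f \<epsilon>\<^sub>f" and h: "conjunction K a b h k \<eta>\<^sub>h \<epsilon>\<^sub>h"
  shows "bij_betw (mate2 K a b \<epsilon>\<^sub>h \<eta>\<^sub>f) (V2cells K f h) (H2cells K k g)"
proof -
  note [simp] = bdry_simps conjunctionD[OF f]
    vhomD[OF conjunctionD(3)[OF f]] hhomD[OF conjunctionD(4)[OF f]]
    vhomD[OF conjunctionD(3)[OF h]] hhomD[OF conjunctionD(4)[OF h]]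
  have "bij_betw (mate K \<epsilon>\<^sub>h \<eta>\<^sub>f (vid K b) (vid K a))
      (squares K (hid K a) (vid K b \<cdot>\<^sub>v h) (f \<cdot>\<^sub>v vid K a) (hid K b))
      (squares K (hid K a \<cdot>\<^sub>h k) (vid K b) (vid K a) (g \<cdot>\<^sub>h hid K b))"
    by (rule bij_betw_mate[OF f h]) (simp_all add: hhom_def vhom_def)
  then show ?thesis
    by (simp add: mate2_def V2cells_eq[OF f] H2cells_eq[OF h])
qed

lemma mate2_vsqid:
  assumes f: "conjunction K a b f g \<eta> \<epsilon>"
  shows "mate2 K a b \<epsilon> \<eta> (vsqid K f) = hsqid K g"
  by (simp add: mate2_eq[OF f f] conjunctionD[OF f]
      squaresD[OF conjunctionD(5)[OF f]] squaresD[OF conjunctionD(6)[OF f]])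

text \<open>Stacking the two mates makes the unit and counit of the middle conjunction, that of
  \<open>h\<close>, meet and cancel. The order of composition reverses.\<close>

lemma mate2_V2comp:
  assumes f: "conjunction K a b f g \<eta>\<^sub>f \<epsilon>\<^sub>f" and h: "conjunction K a b h k \<eta>\<^sub>h \<epsilon>\<^sub>h"
    and l: "conjunction K a b l q \<eta>\<^sub>l \<epsilon>\<^sub>l"
    and \<alpha>: "\<alpha> \<in> V2cells K f h" and \<psi>: "\<psi> \<in> V2cells K h l"
  shows "mate2 K a b \<epsilon>\<^sub>l \<eta>\<^sub>f (V2comp K \<psi> \<alpha>) =
    H2comp K (mate2 K a b \<epsilon>\<^sub>h \<eta>\<^sub>f \<alpha>) (mate2 K a b \<epsilon>\<^sub>l \<eta>\<^sub>h \<psi>)"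
proof -
  note [simp] = bdry_simps conjunctionD[OF f]
    squaresD[OF conjunctionD(5)[OF f]] squaresD[OF conjunctionD(5)[OF h]]
    squaresD[OF conjunctionD(6)[OF l]]
    squaresD[OF \<alpha>[unfolded V2cells_eq[OF f]]] squaresD[OF \<psi>[unfolded V2cells_eq[OF h]]]
    hhomD[OF conjunctionD(4)[OF f]] hhomD[OF conjunctionD(4)[OF l]]
  \<comment> \<open>\<open>conjunction_cancel\<close> with \<xi> as
    \<open>\<epsilon>\<^sub>l \<ast>\<^sub>h \<psi>\<close> and \<zeta> as
    \<open>\<alpha> \<ast>\<^sub>h \<eta>\<^sub>f\<close>; the bracketing of the upper row exposes
    this \<xi>.\<close>
  have "(\<epsilon>\<^sub>h \<ast>\<^sub>h \<alpha> \<ast>\<^sub>h \<eta>\<^sub>f) \<ast>\<^sub>v ((\<epsilon>\<^sub>l \<ast>\<^sub>h \<psi>) \<ast>\<^sub>h \<eta>\<^sub>h) = (\<epsilon>\<^sub>l \<ast>\<^sub>h \<psi>) \<ast>\<^sub>h (\<alpha> \<ast>\<^sub>h \<eta>\<^sub>f)"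
    by (rule conjunction_cancel[OF h]) (rule squaresI; simp)+
  then show ?thesis
    by (simp add: mate2_eq[OF f l] mate2_eq[OF f h] mate2_eq[OF h l]
        V2comp_def H2comp_def hsqcomp_assoc)
qed

lemma V2comp_in_V2cells:
  assumes "conjunction K a b f g \<eta>\<^sub>f \<epsilon>\<^sub>f" "conjunction K a b h k \<eta>\<^sub>h \<epsilon>\<^sub>h"
    and "\<alpha> \<in> V2cells K f h" "\<psi> \<in> V2cells K h l"
  shows "V2comp K \<psi> \<alpha> \<in> V2cells K f l"
  using assms
  by (auto simp: V2cells_eq V2comp_def squares_def bdry_simps dest: conjunctionD)

lemma vsqid_in_V2cells: "conjunction K a b f g \<eta> \<epsilon> \<Longrightarrow> vsqid K f \<in> V2cells K f f"
  by (simp add: V2cells_def squares_def bdry_simps vhomD(1)[OF conjunctionD(3)])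

text \<open>Mates reverse the direction of 2-cells and preserve composites and identities; injectivity
  on endomorphisms carries inverses back.\<close>

lemma mate2_comp_eq_hsqid_iff:
  assumes f: "conjunction K a b f g \<eta>\<^sub>f \<epsilon>\<^sub>f" and h: "conjunction K a b h k \<eta>\<^sub>h \<epsilon>\<^sub>h"
    and \<alpha>: "\<alpha> \<in> V2cells K f h" and \<psi>: "\<psi> \<in> V2cells K h f"
  shows "H2comp K (mate2 K a b \<epsilon>\<^sub>h \<eta>\<^sub>f \<alpha>) (mate2 K a b \<epsilon>\<^sub>f \<eta>\<^sub>h \<psi>) = hsqid K g
    \<longleftrightarrow> V2comp K \<psi> \<alpha> = vsqid K f"
  using bij_betw_imp_inj_on[OF bij_betw_mate2[OF f f]] vsqid_in_V2cells[OF f]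
    V2comp_in_V2cells[OF f h \<alpha> \<psi>] mate2_vsqid[OF f] mate2_V2comp[OF f h f \<alpha> \<psi>]
  by (metis inj_on_eq_iff)

lemma V2iso_iff_H2iso_mate2:
  assumes f: "conjunction K a b f g \<eta>\<^sub>f \<epsilon>\<^sub>f" and h: "conjunction K a b h k \<eta>\<^sub>h \<epsilon>\<^sub>h"
    and \<alpha>: "\<alpha> \<in> V2cells K f h"
  shows "V2iso K f h \<alpha> \<longleftrightarrow> H2iso K k g (mate2 K a b \<epsilon>\<^sub>h \<eta>\<^sub>f \<alpha>)"
proof -
  have "mate2 K a b \<epsilon>\<^sub>h \<eta>\<^sub>f \<alpha> \<in> H2cells K k g"
    using bij_betw_apply[OF bij_betw_mate2[OF f h] \<alpha>] .
  \<comment> \<open>Surjectivity: every candidate inverse of the mate is itself a mate. The two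
    inverse equations then transfer one by one, trading places because mates reverse
    composition.\<close>
  moreover have "H2cells K g k = mate2 K a b \<epsilon>\<^sub>f \<eta>\<^sub>h ` V2cells K h f"
    using bij_betw_mate2[OF h f] by (simp add: bij_betw_def)
  ultimately show ?thesis
    using \<alpha> mate2_comp_eq_hsqid_iff[OF f h \<alpha>] mate2_comp_eq_hsqid_iff[OF h f _ \<alpha>]
    by (auto simp: V2iso_def H2iso_def)
qed

end

theorem proposition5p19:
  fixes K :: "('o, 'v, 'h, 's) double_cat"
    and a b :: 'o and f h :: 'v and g k :: 'h
    and \<eta>\<^sub>f \<epsilon>\<^sub>f \<eta>\<^sub>h \<epsilon>\<^sub>h :: 's
  assumes "double_category K"
    and "conjunction K a b f g \<eta>\<^sub>f \<epsilon>\<^sub>f"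
    and "conjunction K a b h k \<eta>\<^sub>h \<epsilon>\<^sub>h"
  shows "bij_betw (mate2 K a b \<epsilon>\<^sub>h \<eta>\<^sub>f) (V2cells K f h) (H2cells K k g) \<and>
    mate2 K a b \<epsilon>\<^sub>f \<eta>\<^sub>f (vsqid K f) = hsqid K g \<and>
    (\<forall>f' g' \<eta>' \<epsilon>'. conjunction K a b f' g' \<eta>' \<epsilon>' \<longrightarrow>
      (\<forall>\<phi> \<in> V2cells K f' f. \<forall>\<alpha> \<in> V2cells K f h.
        mate2 K a b \<epsilon>\<^sub>h \<eta>' (V2comp K \<alpha> \<phi>) =
          H2comp K (mate2 K a b \<epsilon>\<^sub>f \<eta>' \<phi>) (mate2 K a b \<epsilon>\<^sub>h \<eta>\<^sub>f \<alpha>))) \<and>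
    (\<forall>h' k' \<eta>' \<epsilon>'. conjunction K a b h' k' \<eta>' \<epsilon>' \<longrightarrow>
      (\<forall>\<psi> \<in> V2cells K h h'. \<forall>\<alpha> \<in> V2cells K f h.
        mate2 K a b \<epsilon>' \<eta>\<^sub>f (V2comp K \<psi> \<alpha>) =
          H2comp K (mate2 K a b \<epsilon>\<^sub>h \<eta>\<^sub>f \<alpha>) (mate2 K a b \<epsilon>' \<eta>\<^sub>h \<psi>))) \<and>
    (\<forall>\<alpha> \<in> V2cells K f h. V2iso K f h \<alpha> \<longleftrightarrow> H2iso K k g (mate2 K a b \<epsilon>\<^sub>h \<eta>\<^sub>f \<alpha>)) \<and>
    (\<forall>x \<in> Obj K. \<forall>y \<in> Obj K.
      \<forall>i \<in> hhom K a x. \<forall>n \<in> hhom K y b. \<forall>j \<in> vhom K x a. \<forall>m \<in> vhom K b y.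
        bij_betw (mate K \<epsilon>\<^sub>h \<eta>\<^sub>f m j)
          (squares K i (vcomp K m h) (vcomp K f j) n)
          (squares K (hcomp K i k) m j (hcomp K g n)))"
proof -
  interpret double_category K by fact
  note f = assms(2) and h = assms(3)
  show ?thesis
    \<comment> \<open>\<open>mate2_V2comp\<close> serves twice: leaving the first conjunction free
      gives naturality in \<open>f\<close>, leaving the last free gives naturality in
      \<open>h\<close>.\<close>
    using bij_betw_mate2[OF f h] mate2_vsqid[OF f] mate2_V2comp[OF _ f h] mate2_V2comp[OF f h]
      V2iso_iff_H2iso_mate2[OF f h] bij_betw_mate[OF f h]
    by (intro conjI allI impI ballI) simp_all
qed

end
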